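(* Let $\lambda\in\mathbb{R}_+$, and consider the integer program $$\min\{f(x)\ |\ g(x)\leq 0,\ \|x\|_1\leq\lambda,\ x\in\mathbb{Z}^n\}.$$ For any $\delta\in(0,1)$, Algorithm 1 (described in the context) solves this integer program in $$O\big(n^{((2+\delta)\lfloor\lambda\rfloor)^2/2+1}\big)$$ oracle steps, where computing $f,g$ comprises a single oracle step.
   Context: Notation: $\mathbb{N}=\{0,1,2,\ldots\}$, $[r]=\{1,\ldots,r\}$, $\|x\|_1=\sum_j|x_j|$, $\lfloor r\rfloor$ is the floor of $r$, $\circ$ is the elementwise (Hadamard) product, and $\mathbf{1}(A)$ is $1$ if $A$ is true and $0$ otherwise. The objective $f$ is real-valued, and $g$ is vector-valued with the constraint $g(x)\leq 0$ understood componentwise. The radius $\lambda$ is treated as a fixed parameter. $M_k^N$ denotes the set of vectors $u\in[N]^k$ with $u_i\leq u_{i+1}$ for all $i\in[k-1]$ (i.e. the $k$-multisets of $[N]$, written in nondecreasing order). The map $\varphi:M_k^N\to\mathbb{N}^k$ is given by $(\varphi(u))_1=u_1-1$ and $(\varphi(u))_i=u_i-u_{i-1}$ for $i\in\{2,\ldots,k\}$. For a binary vector $b\in\{0,1\}^n$, $\mathrm{SignPerm}(b)$ is the set of all sign ($+/-$) permutations of the nonzero entries of $b$, i.e. all vectors $s$ with $s_i\in\{-1,+1\}$ if $b_i=1$ and $s_i=0$ if $b_i=0$. Algorithm 1: Set $f^*:=+\infty$. For all $u\in M_n^{\lfloor\lambda\rfloor+1}$: set $v:=\varphi(u)$; for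 all $i\in[n]$ set $b_i:=\mathbf{1}(v_i\neq 0)$; for all $s\in\mathrm{SignPerm}(b)$: set $x:=v\circ s$, and if $f(x)<f^*$ and $g(x)\leq 0$, set $x^*:=x$ and $f^*:=f(x)$. Cost conventions: the elements of $M_k^N$ can each be generated in $O(1)$ oracle time, and the elements of $\mathrm{SignPerm}(b)$ can each be generated in $O(1)$ oracle time (by standard combinatorial generation algorithms); a single scalar arithmetic operation on vector entries (such as one subtraction) costs one step. *)

theory Defs
  imports Complex_Main "HOL-Library.Extended_Real" "HOL-Library.State_Monad"
begin

text \<open>
  Vectors of length \<open>n\<close> are lists of length \<open>n\<close>; their entries are indexed from 0, so the
  mathematical entry \<open>x\<^sub>i\<close> is \<open>x ! (i - 1)\<close>.
\<close>

definition multisets :: "nat \<Rightarrow> nat \<Rightarrow> nat list set" where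
  "multisets k N = {u. length u = k \<and> set u \<subseteq> {1..N} \<and> sorted u}"

text \<open>
  On \<^const>\<open>multisets\<close> the entries of \<open>u\<close> are positive and nondecreasing, so the subtractions
  on \<^typ>\<open>nat\<close> never truncate.
\<close>

definition phi :: "nat list \<Rightarrow> nat list" where
  "phi u = map (\<lambda>i. if i = 0 then u ! 0 - 1 else u ! i - u ! (i - 1)) [0..<length u]"

definition sign_perm :: "nat list \<Rightarrow> int list set" where
  "sign_perm b = {s. length s = length b \<and>
     (\<forall>i<length b. (b ! i = 1 \<longrightarrow> s ! i \<in> {-1, 1}) \<and> (b ! i = 0 \<longrightarrow> s ! i = 0))}"

definition hadamard :: "nat list \<Rightarrow> int list \<Rightarrow> int list" where
  "hadamard v s = map2 (\<lambda>a t. int a * t) v s"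

definition nonpos :: "real list \<Rightarrow> bool" where
  "nonpos y \<longleftrightarrow> (\<forall>a\<in>set y. a \<le> 0)"


text \<open>
  The integer program.  A result consists of the incumbent \<open>x\<^sup>*\<close> (\<^term>\<open>None\<close> as long as it has
  not been assigned) and the value \<open>f\<^sup>*\<close>.  If the program is infeasible, solving it means to
  report \<open>f\<^sup>* = +\<infinity>\<close> without assigning \<open>x\<^sup>*\<close>.
\<close>

type_synonym result = "int list option \<times> ereal"

definition feasible :: "(int list \<Rightarrow> real list) \<Rightarrow> nat \<Rightarrow> real \<Rightarrow> int list set" where
  "feasible g n lam =
     {x. length x = n \<and> nonpos (g x) \<and> real_of_int (\<Sum>a\<leftarrow>x. \<bar>a\<bar>) \<le> lam}"

definition solves ::
  "result \<Rightarrow> (int list \<Rightarrow> real) \<Rightarrow> (int list \<Rightarrow> real list) \<Rightarrow> nat \<Rightarrow> real \<Rightarrow> bool" where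
  "solves r f g n lam \<longleftrightarrow>
     (if feasible g n lam = {} then r = (None, \<infinity>)
      else \<exists>x\<in>feasible g n lam. r = (Some x, ereal (f x)) \<and> (\<forall>y\<in>feasible g n lam. f x \<le> f y))"


text \<open>Programs that count their oracle steps: the state is the number of steps made so far.\<close>

type_synonym 'a counted = "(nat, 'a) state"

definition charge :: "nat \<Rightarrow> unit counted" where
  "charge t = State (\<lambda>k. ((), k + t))"

text \<open>A vector whose entries are obtained by one scalar operation each.\<close>

definition entrywise :: "'a list \<Rightarrow> 'a list counted" where
  "entrywise v = do { charge (length v); State_Monad.return v }"

text \<open>
  The run of a generation procedure: the generated elements in the order in which they appear,
  each paired with the number of steps spent on generating it.
\<close>

type_synonym 'a enumeration = "('a \<times> nat) list"

definition generates :: "nat \<Rightarrow> 'a set \<Rightarrow> 'a enumeration \<Rightarrow> bool" where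
  "generates c S e \<longleftrightarrow>
     distinct (map fst e) \<and> set (map fst e) = S \<and> (\<forall>(a, t)\<in>set e. t \<le> c)"

fun for_all :: "'a enumeration \<Rightarrow> ('a \<Rightarrow> 's \<Rightarrow> 's counted) \<Rightarrow> 's \<Rightarrow> 's counted" where
  "for_all [] body st = State_Monad.return st"
| "for_all ((a, t) # e) body st =
     do { charge t; st' \<leftarrow> body a st; for_all e body st' }"

text \<open>
  The body of the inner loop: computing \<open>x = v \<circ> s\<close>, one oracle call giving \<open>f x\<close> and
  the truth value of \<open>g x \<le> 0\<close>, one comparison with \<open>f\<^sup>*\<close>, and, if the incumbent improves,
  the assignments of \<open>x\<^sup>*\<close> (entry by entry) and \<open>f\<^sup>*\<close>.
\<close>

definition try_candidate ::
  "(int list \<Rightarrow> real) \<Rightarrow> (int list \<Rightarrow> real list) \<Rightarrow> nat list \<Rightarrow> int list \<Rightarrow> result \<Rightarrow> result counted"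
  where
  "try_candidate f g v s st = do {
     x \<leftarrow> entrywise (hadamard v s);
     charge 1;
     charge 1;
     if ereal (f x) < snd st \<and> nonpos (g x)
     then do { x' \<leftarrow> entrywise x; charge 1; State_Monad.return (Some x', ereal (f x)) }
     else State_Monad.return st }"

text \<open>
  \<open>enumM k N\<close> and \<open>enumS b\<close> are the procedures generating \<^term>\<open>multisets k N\<close> and
  \<^term>\<open>sign_perm b\<close>.
\<close>

definition algorithm1 ::
  "(nat \<Rightarrow> nat \<Rightarrow> nat list enumeration) \<Rightarrow> (nat list \<Rightarrow> int list enumeration) \<Rightarrow>
   (int list \<Rightarrow> real) \<Rightarrow> (int list \<Rightarrow> real list) \<Rightarrow> nat \<Rightarrow> real \<Rightarrow> result counted" where
  "algorithm1 enumM enumS f g n lam = do {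
     charge 1;
     for_all (enumM n (nat \<lfloor>lam\<rfloor> + 1)) (\<lambda>u st. do {
       v \<leftarrow> entrywise (phi u);
       b \<leftarrow> entrywise (map (\<lambda>a. of_bool (a \<noteq> 0)) v);
       for_all (enumS b) (try_candidate f g v) st }) (None, \<infinity>) }"

definition outcome :: "'a counted \<Rightarrow> 'a" where
  "outcome p = fst (run_state p 0)"

definition steps :: "'a counted \<Rightarrow> nat" where
  "steps p = snd (run_state p 0)"

end

theory Submission
  imports Defs
begin

text \<open>
  With \<open>L = \<lfloor>lam\<rfloor>\<close>, an integer vector satisfies \<open>\<parallel>x\<parallel>\<^sub>1 \<le> lam\<close> iff \<open>\<parallel>x\<parallel>\<^sub>1 \<le> L\<close>, since its norm
  is an integer.  Such an \<open>x\<close> is determined by the vector \<open>v\<close> of its absolute values and a choice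
  of signs on the support of \<open>v\<close>, and the vectors \<open>v\<close> with entry sum at most \<open>L\<close> are exactly the
  difference vectors \<open>phi u\<close> of the multisets \<open>u\<close> of \<open>{1..L + 1}\<close>, recovered by forming partial sums
  (\<open>phi_image_multisets\<close>).  Hence the candidates tested by the algorithm are the lattice points of
  the \<open>L\<close>-ball and nothing else (\<open>candidates_eq_ball\<close>).  Keeping the best candidate that satisfies
  \<open>g x \<le> 0\<close> therefore solves the program.

  For the running time, a nondecreasing word over \<open>{1..L + 1}\<close> is given by the positions of its
  \<open>L\<close> jumps, so there are at most \<open>(n + 1) ^ L\<close> multisets (\<open>card_multisets_le\<close>).  A vector \<open>v\<close>
  with entry sum at most \<open>L\<close> has at most \<open>L\<close> nonzero entries, so it carries at most \<open>2 ^ L\<close> sign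
  patterns, which is a constant (\<open>card_sign_perm_le\<close>).  Each candidate costs \<open>O(n)\<close> steps, and
  the total is \<open>O(n ^ (L + 1))\<close>.  This is stronger than what is claimed: as
  \<open>(2 + \<delta>)\<^sup>2 / 2 \<ge> 2\<close>, the claimed exponent is at least \<open>2 * L\<^sup>2 + 1 \<ge> L + 1\<close>.
\<close>

section \<open>Counting steps of programs\<close>

text \<open>
  The result and the number of steps must not depend on the current counter; this is what makes
  the bounds additive under sequential composition.
\<close>

definition runs_to :: "'a counted \<Rightarrow> 'a \<Rightarrow> nat \<Rightarrow> bool" where
  "runs_to p r T \<longleftrightarrow> (\<forall>k. \<exists>t\<le>T. run_state p k = (r, k + t))"

lemma runs_to_return: "runs_to (State_Monad.return r) r 0"
  by (simp add: runs_to_def State_Monad.return_def)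

lemma runs_to_charge: "runs_to (charge t) () t"
  by (auto simp: runs_to_def charge_def)

lemma runs_to_mono: "runs_to p r T \<Longrightarrow> T \<le> T' \<Longrightarrow> runs_to p r T'"
  unfolding runs_to_def by (meson order_trans)

lemma runs_to_bind:
  assumes "runs_to p r T" and "runs_to (q r) r' T'"
  shows "runs_to (State_Monad.bind p q) r' (T + T')"
  unfolding runs_to_def
proof
  fix k
  obtain t where t: "t \<le> T" "run_state p k = (r, k + t)"
    using assms(1) by (auto simp: runs_to_def)
  obtain t' where t': "t' \<le> T'" "run_state (q r) (k + t) = (r', k + t + t')"
    using assms(2) by (auto simp: runs_to_def)
  show "\<exists>s\<le>T + T'. run_state (State_Monad.bind p q) k = (r', k + s)"
    using t t' by (intro exI[of _ "t + t'"]) (simp add: State_Monad.bind_def add.assoc)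
qed

lemma runs_to_entrywise: "runs_to (entrywise v) v (length v)"
  unfolding entrywise_def
  using runs_to_bind[OF runs_to_charge runs_to_return] by simp

lemma runs_to_for_all:
  assumes "\<And>a t. (a, t) \<in> set e \<Longrightarrow> t \<le> c"
    and "\<And>a st. a \<in> set (map fst e) \<Longrightarrow> runs_to (body a st) (step a st) T"
  shows "runs_to (for_all e body st) (fold step (map fst e) st) (length e * (c + T))"
  using assms
proof (induction e arbitrary: st)
  case Nil
  then show ?case by (simp add: runs_to_return)
next
  case (Cons q e)
  obtain a t where q: "q = (a, t)" by fastforce
  have "runs_to (charge t) () c"
    using Cons.prems(1) q by (intro runs_to_mono[OF runs_to_charge]) auto
  moreover have "runs_to (body a st) (step a st) T"
    using Cons.prems(2) q by simp
  moreover have "runs_to (for_all e body (step a st)) (fold step (map fst e) (step a st))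
      (length e * (c + T))"
    by (rule Cons.IH) (use Cons.prems in auto)
  ultimately have "runs_to (for_all (q # e) body st) (fold step (map fst (q # e)) st)
      (c + (T + length e * (c + T)))"
    unfolding q by (auto intro!: runs_to_bind)
  then show ?case by (rule runs_to_mono) simp
qed

lemma outcome_runs_to: "runs_to p r T \<Longrightarrow> outcome p = r"
  unfolding runs_to_def outcome_def by (metis fst_conv)

lemma steps_runs_to: "runs_to p r T \<Longrightarrow> steps p \<le> T"
  unfolding runs_to_def steps_def by (metis add_0 snd_conv)

lemma generates_length: "generates c S e \<Longrightarrow> length e = card S"
  unfolding generates_def by (metis distinct_card length_map)


section \<open>Keeping the best candidate\<close>

definition update ::
  "(int list \<Rightarrow> real) \<Rightarrow> (int list \<Rightarrow> real list) \<Rightarrow> int list \<Rightarrow> result \<Rightarrow> result" where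
  "update f g x st = (if ereal (f x) < snd st \<and> nonpos (g x) then (Some x, ereal (f x)) else st)"

definition minimises :: "result \<Rightarrow> (int list \<Rightarrow> real) \<Rightarrow> int list set \<Rightarrow> bool" where
  "minimises r f S \<longleftrightarrow>
     (if S = {} then r = (None, \<infinity>)
      else \<exists>x\<in>S. r = (Some x, ereal (f x)) \<and> (\<forall>y\<in>S. f x \<le> f y))"

lemma solves_iff_minimises: "solves r f g n lam \<longleftrightarrow> minimises r f (feasible g n lam)"
  by (simp add: solves_def minimises_def)

lemma update_minimises:
  assumes "minimises st f {y \<in> A. nonpos (g y)}"
  shows "minimises (update f g x st) f {y \<in> insert x A. nonpos (g y)}"
proof (cases "nonpos (g x)")
  case False
  then have "{y \<in> insert x A. nonpos (g y)} = {y \<in> A. nonpos (g y)}" by auto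
  then show ?thesis using assms False by (simp add: update_def)
next
  case True
  then have S: "{y \<in> insert x A. nonpos (g y)} = insert x {y \<in> A. nonpos (g y)}" by auto
  show ?thesis
  proof (cases "{y \<in> A. nonpos (g y)} = {}")
    case empty: True
    then have "st = (None, \<infinity>)" using assms by (simp add: minimises_def)
    then show ?thesis unfolding S empty using True by (simp add: minimises_def update_def)
  next
    case False
    then obtain z where z: "z \<in> {y \<in> A. nonpos (g y)}" "st = (Some z, ereal (f z))"
      "\<forall>y\<in>{y \<in> A. nonpos (g y)}. f z \<le> f y"
      using assms unfolding minimises_def by (metis (lifting))
    show ?thesis
    proof (cases "f x < f z")
      case True
      then show ?thesis unfolding S using z \<open>nonpos (g x)\<close>
        by (force simp: minimises_def update_def)
    next
      case False
      then show ?thesis unfolding S using z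
        by (force simp: minimises_def update_def)
    qed
  qed
qed

lemma fold_update_minimises:
  "minimises (fold (update f g) xs (None, \<infinity>)) f {x \<in> set xs. nonpos (g x)}"
proof (induction xs rule: rev_induct)
  case Nil
  then show ?case by (simp add: minimises_def)
next
  case (snoc x xs)
  then show ?case using update_minimises[OF snoc.IH, of x] by simp
qed

lemma fold_fold_eq_fold_concat:
  "fold (\<lambda>u. fold (\<lambda>s. h (k u s)) (l u)) us = fold h (concat (map (\<lambda>u. map (k u) (l u)) us))"
  by (induction us) (simp_all add: fold_map comp_def)


section \<open>Multisets and their difference vectors\<close>

lemma length_phi [simp]: "length (phi u) = length u"
  by (simp add: phi_def)

lemma phi_Nil: "phi [] = []"
  by (simp add: phi_def)

lemma phi_snoc: "phi (u @ [a]) = phi u @ [if u = [] then a - 1 else a - last u]"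
  by (auto simp: phi_def nth_append last_conv_nth)

lemma finite_multisets: "finite (multisets k N)"
  by (rule finite_subset[OF _ finite_lists_length_eq[of "{1..N}" k]]) (auto simp: multisets_def)

text \<open>The differences telescope.\<close>

lemma sum_list_phi:
  assumes "u \<noteq> []" and "sorted u" and "\<forall>a\<in>set u. 1 \<le> a"
  shows "sum_list (phi u) = last u - 1"
  using assms
proof (induction u rule: rev_induct)
  case (snoc a u)
  show ?case
  proof (cases "u = []")
    case False
    have "1 \<le> last u" "last u \<le> a"
      using snoc.prems False by (auto simp: sorted_append)
    then show ?thesis
      using snoc False by (simp add: phi_snoc sorted_append)
  qed (use phi_snoc[of "[]" a] in \<open>simp add: phi_Nil\<close>)
qed simp

text \<open>The preimage \<open>u\<close> of \<open>v\<close> consists of the partial sums of \<open>v\<close>, each increased by 1.\<close>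

lemma phi_surj:
  "\<exists>u. phi u = v \<and> sorted u \<and> (\<forall>a\<in>set u. 1 \<le> a \<and> a \<le> Suc (sum_list v))
       \<and> (u \<noteq> [] \<longrightarrow> last u = Suc (sum_list v))"
proof (induction v rule: rev_induct)
  case Nil
  then show ?case by (intro exI[of _ "[]"]) (simp add: phi_Nil)
next
  case (snoc d v)
  then obtain u where u: "phi u = v" "sorted u" "\<forall>a\<in>set u. 1 \<le> a \<and> a \<le> Suc (sum_list v)"
    "u \<noteq> [] \<longrightarrow> last u = Suc (sum_list v)"
    by blast
  have "u = [] \<Longrightarrow> v = []" using u(1) phi_Nil by auto
  then show ?case using u
    by (intro exI[of _ "u @ [Suc (sum_list v + d)]"])
      (auto simp: phi_snoc sorted_append intro: le_SucI trans_le_add1)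
qed

lemma phi_image_multisets:
  "phi ` multisets n (Suc L) = {v. length v = n \<and> sum_list v \<le> L}"
proof (intro equalityI subsetI)
  fix v assume "v \<in> phi ` multisets n (Suc L)"
  then obtain u where u: "v = phi u" "length u = n" "set u \<subseteq> {1..Suc L}" "sorted u"
    by (auto simp: multisets_def)
  have "sum_list (phi u) \<le> L"
  proof (cases "u = []")
    case False
    then have "last u \<le> Suc L" using u(3) last_in_set by fastforce
    moreover have "\<forall>a\<in>set u. 1 \<le> a" using u(3) by auto
    ultimately show ?thesis using sum_list_phi[OF False u(4)] by simp
  qed (simp add: phi_Nil)
  then show "v \<in> {v. length v = n \<and> sum_list v \<le> L}" using u by simp
next
  fix v :: "nat list" assume v: "v \<in> {v. length v = n \<and> sum_list v \<le> L}"
  obtain u where u: "phi u = v" "sorted u" "\<forall>a\<in>set u. 1 \<le> a \<and> a \<le> Suc (sum_list v)"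
    using phi_surj by blast
  have "length u = n" using u(1) v by auto
  moreover have "set u \<subseteq> {1..Suc L}" using u(3) v by fastforce
  ultimately show "v \<in> phi ` multisets n (Suc L)"
    using u by (auto simp: multisets_def)
qed

text \<open>
  In a nondecreasing word the occurrences of the largest letter form a final segment; cutting it
  off leaves a word over a smaller alphabet.
\<close>

lemma multisets_Suc_split:
  assumes "u \<in> multisets k (Suc N)"
  shows "\<exists>j\<le>k. \<exists>w\<in>multisets j N. u = w @ replicate (k - j) (Suc N)"
  using assms
proof (induction u arbitrary: k rule: rev_induct)
  case Nil
  then show ?case by (auto simp: multisets_def)
next
  case (snoc a u)
  show ?case
  proof (cases "a \<le> N")
    case True
    then have "u @ [a] \<in> multisets k N"
      using snoc.prems by (fastforce simp: multisets_def sorted_append)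
    then show ?thesis by (intro exI[of _ k]) auto
  next
    case False
    then have a: "a = Suc N" using snoc.prems by (auto simp: multisets_def)
    obtain k' where k: "k = Suc k'" using snoc.prems by (auto simp: multisets_def)
    have "u \<in> multisets k' (Suc N)"
      using snoc.prems k by (auto simp: multisets_def sorted_append)
    then obtain j w where j: "j \<le> k'" "w \<in> multisets j N" "u = w @ replicate (k' - j) (Suc N)"
      using snoc.IH by blast
    then show ?thesis using a k
      by (intro exI[of _ j] conjI bexI[of _ w])
        (auto simp: Suc_diff_le replicate_append_same)
  qed
qed

text \<open>
  Instead of the exact value, the binomial coefficient \<open>k + N\<close> over \<open>N\<close>, a power is used: it is
  already polynomial in \<open>k\<close> of the right degree \<open>N\<close>.
\<close>

lemma card_multisets_le: "card (multisets k (Suc N)) \<le> Suc k ^ N"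
proof (induction N arbitrary: k)
  case 0
  have "multisets k (Suc 0) \<subseteq> {replicate k (Suc 0)}"
    by (auto simp: multisets_def intro!: replicate_eqI)
  then have "card (multisets k (Suc 0)) \<le> card {replicate k (Suc 0)}"
    by (intro card_mono) simp_all
  then show ?case by simp
next
  case (Suc N)
  let ?A = "\<lambda>j. (\<lambda>w. w @ replicate (k - j) (Suc (Suc N))) ` multisets j (Suc N)"
  have "multisets k (Suc (Suc N)) \<subseteq> (\<Union>j\<in>{..k}. ?A j)"
  proof
    fix u assume "u \<in> multisets k (Suc (Suc N))"
    then obtain j w where "j \<le> k" "w \<in> multisets j (Suc N)"
      "u = w @ replicate (k - j) (Suc (Suc N))"
      using multisets_Suc_split by blast
    then show "u \<in> (\<Union>j\<in>{..k}. ?A j)" by blast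
  qed
  then have "card (multisets k (Suc (Suc N))) \<le> card (\<Union>j\<in>{..k}. ?A j)"
    by (intro card_mono) (auto simp: finite_multisets)
  also have "\<dots> \<le> (\<Sum>j\<le>k. card (?A j))"
    by (intro card_UN_le) simp
  also have "\<dots> \<le> (\<Sum>j\<le>k. Suc k ^ N)"
  proof (intro sum_mono)
    fix j assume "j \<in> {..k}"
    have "card (?A j) \<le> card (multisets j (Suc N))"
      by (rule card_image_le[OF finite_multisets])
    also have "\<dots> \<le> Suc j ^ N" by (rule Suc.IH)
    also have "\<dots> \<le> Suc k ^ N" using \<open>j \<in> {..k}\<close> by (intro power_mono) auto
    finally show "card (?A j) \<le> Suc k ^ N" .
  qed
  also have "\<dots> = Suc k ^ Suc N" by simp
  finally show ?case .
qed


section \<open>Sign patterns\<close>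

lemma sign_perm_eq_list_all2:
  "sign_perm b = {s. list_all2 (\<lambda>a t. (a = 1 \<longrightarrow> t \<in> {-1, 1}) \<and> (a = 0 \<longrightarrow> t = 0)) b s}"
  by (auto simp: sign_perm_def list_all2_conv_all_nth)

lemma card_sign_perm_le:
  assumes "set b \<subseteq> {0, 1}"
  shows "finite (sign_perm b) \<and> card (sign_perm b) \<le> 2 ^ sum_list b"
  using assms
proof (induction b)
  case Nil
  then show ?case by (simp add: sign_perm_eq_list_all2)
next
  case (Cons a b)
  then have IH: "finite (sign_perm b)" "card (sign_perm b) \<le> 2 ^ sum_list b" by auto
  from Cons.prems have "a = 0 \<or> a = 1" by auto
  then show ?case
  proof
    assume a: "a = 0"
    then have "sign_perm (a # b) = (#) 0 ` sign_perm b"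
      by (auto simp: sign_perm_eq_list_all2 list_all2_Cons1)
    then show ?thesis using IH a card_image_le[OF IH(1), of "(#) 0"] by simp
  next
    assume a: "a = 1"
    then have S: "sign_perm (a # b) = (#) (-1) ` sign_perm b \<union> (#) 1 ` sign_perm b"
      by (auto simp: sign_perm_eq_list_all2 list_all2_Cons1)
    have "card (sign_perm (a # b)) \<le> card (sign_perm b) + card (sign_perm b)"
      unfolding S
      by (rule order_trans[OF card_Un_le]) (intro add_mono card_image_le IH(1))
    then show ?thesis using IH a S by simp
  qed
qed

definition support :: "nat list \<Rightarrow> nat list" where
  "support v = map (\<lambda>a. of_bool (a \<noteq> 0)) v"

lemma length_support [simp]: "length (support v) = length v"
  by (simp add: support_def)

lemma set_support: "set (support v) \<subseteq> {0, 1}"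
  by (auto simp: support_def)

lemma sum_list_support_le: "sum_list (support v) \<le> sum_list v"
  by (induction v) (auto simp: support_def)

lemma length_hadamard [simp]: "length (hadamard v s) = min (length v) (length s)"
  by (simp add: hadamard_def)

lemma abs_hadamard:
  assumes "s \<in> sign_perm (support v)"
  shows "map (\<lambda>a. nat \<bar>a\<bar>) (hadamard v s) = v"
  using assms
proof (induction v arbitrary: s)
  case Nil
  then show ?case by (simp add: hadamard_def)
next
  case (Cons a v)
  then obtain t s' where s: "s = t # s'" "s' \<in> sign_perm (support v)"
    and t: "of_bool (a \<noteq> 0) = (1 :: nat) \<longrightarrow> t \<in> {-1, 1}"
    unfolding sign_perm_eq_list_all2 support_def list.map mem_Collect_eq list_all2_Cons1 by blast
  have "a \<noteq> 0 \<Longrightarrow> t = 1 \<or> t = -1" using t by auto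
  then show ?case using Cons.IH[OF s(2)] s(1)
    by (cases "a = 0") (auto simp: hadamard_def)
qed

lemma sum_list_nat_abs: "int (\<Sum>a\<leftarrow>x. nat \<bar>a\<bar>) = (\<Sum>a\<leftarrow>x. \<bar>a\<bar>)"
  by (induction x) auto

text \<open>
  A lattice point \<open>x\<close> arises from the absolute values and the signs of its entries; as
  \<open>sgn 0 = 0\<close>, the signs form a pattern on the support.  Conversely, multiplying by signs keeps
  the absolute values, hence the norm.
\<close>

lemma candidates_eq_ball:
  "(\<Union>u\<in>multisets n (Suc L). hadamard (phi u) ` sign_perm (support (phi u)))
     = {x. length x = n \<and> (\<Sum>a\<leftarrow>x. \<bar>a\<bar>) \<le> int L}"
proof -
  have "(\<Union>u\<in>multisets n (Suc L). hadamard (phi u) ` sign_perm (support (phi u)))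
      = (\<Union>v\<in>phi ` multisets n (Suc L). hadamard v ` sign_perm (support v))"
    by simp
  also have "\<dots> = {x. length x = n \<and> (\<Sum>a\<leftarrow>x. \<bar>a\<bar>) \<le> int L}"
    unfolding phi_image_multisets
  proof (intro equalityI subsetI)
    fix x assume "x \<in> (\<Union>v\<in>{v. length v = n \<and> sum_list v \<le> L}.
      hadamard v ` sign_perm (support v))"
    then obtain v s where v: "length v = n" "sum_list v \<le> L" "s \<in> sign_perm (support v)"
      "x = hadamard v s" by blast
    then have "map (\<lambda>a. nat \<bar>a\<bar>) x = v" using abs_hadamard by simp
    then show "x \<in> {x. length x = n \<and> (\<Sum>a\<leftarrow>x. \<bar>a\<bar>) \<le> int L}"
      using v(1,2) sum_list_nat_abs[of x] by auto
  next
    fix x assume x: "x \<in> {x. length x = n \<and> (\<Sum>a\<leftarrow>x. \<bar>a\<bar>) \<le> int L}"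
    let ?v = "map (\<lambda>a. nat \<bar>a\<bar>) x"
    have "map sgn x \<in> sign_perm (support ?v)"
      by (induction x) (auto simp: sign_perm_eq_list_all2 support_def sgn_if)
    moreover have "x = hadamard ?v (map sgn x)"
      by (induction x) (auto simp: hadamard_def abs_mult_sgn)
    moreover have "length ?v = n" "sum_list ?v \<le> L"
      using x sum_list_nat_abs[of x] by auto
    ultimately show "x \<in> (\<Union>v\<in>{v. length v = n \<and> sum_list v \<le> L}.
      hadamard v ` sign_perm (support v))" by blast
  qed
  finally show ?thesis .
qed


section \<open>Correctness and running time\<close>

lemma feasible_eq_ball:
  assumes "0 \<le> lam"
  shows "feasible g n lam
    = {x \<in> {x. length x = n \<and> (\<Sum>a\<leftarrow>x. \<bar>a\<bar>) \<le> int (nat \<lfloor>lam\<rfloor>)}. nonpos (g x)}"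
  using assms by (auto simp: feasible_def le_floor_iff)

lemma runs_to_try_candidate:
  assumes "length v = n"
  shows "runs_to (try_candidate f g v s st) (update f g (hadamard v s) st) (2 * n + 3)"
proof -
  let ?x = "hadamard v s"
  have x: "runs_to (entrywise ?x) ?x n"
    by (rule runs_to_mono[OF runs_to_entrywise]) (simp add: assms)
  have "runs_to (if ereal (f ?x) < snd st \<and> nonpos (g ?x)
      then State_Monad.bind (entrywise ?x) (\<lambda>x'. State_Monad.bind (charge 1)
        (\<lambda>_. State_Monad.return (Some x', ereal (f ?x))))
      else State_Monad.return st) (update f g ?x st) (n + (1 + 0))"
  proof (cases "ereal (f ?x) < snd st \<and> nonpos (g ?x)")
    case True
    have "runs_to (State_Monad.bind (entrywise ?x) (\<lambda>x'. State_Monad.bind (charge 1)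
        (\<lambda>_. State_Monad.return (Some x', ereal (f ?x)))))
        (Some ?x, ereal (f ?x)) (n + (1 + 0))"
      by (intro runs_to_bind[OF x] runs_to_bind[OF runs_to_charge] runs_to_return)
    then show ?thesis using True by (simp add: update_def)
  next
    case False
    have "runs_to (State_Monad.return st) st (n + (1 + 0))"
      by (rule runs_to_mono[OF runs_to_return]) simp
    then show ?thesis unfolding update_def if_not_P[OF False] .
  qed
  then have "runs_to (try_candidate f g v s st) (update f g ?x st) (n + (1 + (1 + (n + (1 + 0)))))"
    unfolding try_candidate_def
    by (intro runs_to_bind[OF x] runs_to_bind[OF runs_to_charge])
  then show ?thesis by (rule runs_to_mono) simp
qed

text \<open>
  The inner loop starts from the incumbent that the previous inner loop left behind, so the two
  nested loops amount to one pass over the concatenated list of candidates.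
\<close>

lemma runs_to_algorithm1:
  fixes n L c :: nat
  assumes enumM: "\<And>k N. generates c (multisets k N) (enumM k N)"
    and enumS: "\<And>b. set b \<subseteq> {0, 1} \<Longrightarrow> generates c (sign_perm b) (enumS b)"
    and L: "L = nat \<lfloor>lam\<rfloor>"
  defines "candidates \<equiv> concat (map
      (\<lambda>u. map (hadamard (phi u)) (map fst (enumS (support (phi u)))))
      (map fst (enumM n (Suc L))))"
  shows "runs_to (algorithm1 enumM enumS f g n lam)
    (fold (update f g) candidates (None, \<infinity>))
    (1 + Suc n ^ L * (c + (n + (n + 2 ^ L * (c + (2 * n + 3))))))"
proof -
  let ?l = "\<lambda>u. map fst (enumS (support (phi u)))"
  define stage where "stage u = fold (\<lambda>s. update f g (hadamard (phi u) s)) (?l u)" for u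
  have inner: "runs_to (for_all (enumS (support (phi u))) (try_candidate f g (phi u)) st)
      (stage u st) (2 ^ L * (c + (2 * n + 3)))"
    if u: "u \<in> multisets n (Suc L)" for u st
  proof -
    let ?b = "support (phi u)"
    have gen: "generates c (sign_perm ?b) (enumS ?b)"
      by (rule enumS[OF set_support])
    have len: "length (phi u) = n" using u by (simp add: multisets_def)
    have "sum_list (phi u) \<le> L"
      using u phi_image_multisets[of n L] by blast
    then have "sum_list ?b \<le> L" using sum_list_support_le[of "phi u"] by simp
    have "length (enumS ?b) = card (sign_perm ?b)" by (rule generates_length[OF gen])
    also have "\<dots> \<le> 2 ^ sum_list ?b" using card_sign_perm_le[OF set_support] by blast
    also have "\<dots> \<le> 2 ^ L" using \<open>sum_list ?b \<le> L\<close> by simp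
    finally have le: "length (enumS ?b) \<le> 2 ^ L" .
    have "runs_to (for_all (enumS ?b) (try_candidate f g (phi u)) st) (stage u st)
        (length (enumS ?b) * (c + (2 * n + 3)))"
      unfolding stage_def
      by (rule runs_to_for_all) (use gen runs_to_try_candidate[OF len] in \<open>auto simp: generates_def\<close>)
    then show ?thesis by (rule runs_to_mono) (use le in \<open>simp only: mult_le_mono1\<close>)
  qed
  define body where "body u st = State_Monad.bind (entrywise (phi u))
      (\<lambda>v. State_Monad.bind (entrywise (support v))
      (\<lambda>b. for_all (enumS b) (try_candidate f g v) st))" for u st
  have body: "runs_to (body u st) (stage u st) (n + (n + 2 ^ L * (c + (2 * n + 3))))"
    if u: "u \<in> multisets n (Suc L)" for u st
  proof -
    have "length (phi u) = n" using u by (simp add: multisets_def)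
    then have "runs_to (entrywise (phi u)) (phi u) n"
      "runs_to (entrywise (support (phi u))) (support (phi u)) n"
      using runs_to_entrywise[of "phi u"] runs_to_entrywise[of "support (phi u)"] by auto
    then show ?thesis unfolding body_def
    proof (intro runs_to_bind)
      show "runs_to (for_all (enumS (support (phi u))) (try_candidate f g (phi u)) st)
          (stage u st) (2 ^ L * (c + (2 * n + 3)))"
        by (rule inner[OF u])
    qed
  qed
  let ?e = "enumM n (Suc L)"
  have gen: "generates c (multisets n (Suc L)) ?e" by (rule enumM)
  have "length ?e \<le> Suc n ^ L"
    using generates_length[OF gen] card_multisets_le[of n L] by simp
  moreover have "runs_to (for_all ?e body (None, \<infinity>)) (fold stage (map fst ?e) (None, \<infinity>))
      (length ?e * (c + (n + (n + 2 ^ L * (c + (2 * n + 3))))))"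
    by (rule runs_to_for_all) (use gen body in \<open>auto simp: generates_def\<close>)
  ultimately have "runs_to (for_all ?e body (None, \<infinity>)) (fold stage (map fst ?e) (None, \<infinity>))
      (Suc n ^ L * (c + (n + (n + 2 ^ L * (c + (2 * n + 3))))))"
    by (meson mult_le_mono1 runs_to_mono)
  moreover have "fold stage (map fst ?e) (None, \<infinity>) = fold (update f g) candidates (None, \<infinity>)"
    unfolding candidates_def fold_fold_eq_fold_concat[symmetric] stage_def ..
  moreover have "algorithm1 enumM enumS f g n lam
      = State_Monad.bind (charge 1) (\<lambda>_. for_all ?e body (None, \<infinity>))"
    unfolding algorithm1_def body_def[abs_def] support_def L by simp
  ultimately show ?thesis by (simp only:) (rule runs_to_bind[OF runs_to_charge])
qed

text \<open>
  The constant absorbs \<open>Suc n \<le> 2 * n\<close> and \<open>1 \<le> n\<close>, whence \<open>2 ^ L\<close> for the multisets, a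
  second \<open>2 ^ L\<close> for the sign patterns, and \<open>(2 * c + 7) * n\<close> for one candidate, charged as if
  the work on its multiset were repeated for every sign pattern.
\<close>

lemma step_count_le:
  fixes n L c :: nat
  assumes "1 \<le> n"
  shows "1 + Suc n ^ L * (c + (n + (n + 2 ^ L * (c + (2 * n + 3)))))
    \<le> (1 + 2 ^ L * 2 ^ L * (2 * c + 7)) * n ^ Suc L"
proof -
  have cost: "2 * c + 4 * n + 3 \<le> (2 * c + 7) * n"
    using assms by (cases n) (auto simp: algebra_simps)
  have "Suc n ^ L \<le> (2 * n) ^ L" using assms by (intro power_mono) auto
  then have multisets: "Suc n ^ L \<le> 2 ^ L * n ^ L" by (simp add: power_mult_distrib)
  have "c + (n + (n + 2 ^ L * (c + (2 * n + 3)))) = 1 * (c + 2 * n) + 2 ^ L * (c + (2 * n + 3))"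
    by simp
  also have "\<dots> \<le> 2 ^ L * (c + 2 * n) + 2 ^ L * (c + (2 * n + 3))"
    by (intro add_mono mult_right_mono) auto
  also have "\<dots> = 2 ^ L * (2 * c + 4 * n + 3)" by (simp add: algebra_simps)
  also have "\<dots> \<le> 2 ^ L * ((2 * c + 7) * n)"
    using cost by (intro mult_left_mono) auto
  finally have per_multiset: "c + (n + (n + 2 ^ L * (c + (2 * n + 3)))) \<le> 2 ^ L * ((2 * c + 7) * n)" .
  have "Suc n ^ L * (c + (n + (n + 2 ^ L * (c + (2 * n + 3)))))
      \<le> (2 ^ L * n ^ L) * (2 ^ L * ((2 * c + 7) * n))"
    by (intro mult_mono multisets per_multiset) auto
  also have "\<dots> = (2 ^ L * 2 ^ L * (2 * c + 7)) * n ^ Suc L" by simp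
  finally show ?thesis
    unfolding add_mult_distrib[of 1] mult_1 using assms by (intro add_mono) auto
qed

lemma exponent_le:
  fixes \<delta> :: real and L :: nat
  assumes "0 \<le> \<delta>"
  shows "real (Suc L) \<le> ((2 + \<delta>) * real L)\<^sup>2 / 2 + 1"
proof -
  have "2 * real L \<le> (2 + \<delta>) * real L" using assms by (intro mult_right_mono) auto
  then have "(2 * real L)\<^sup>2 \<le> ((2 + \<delta>) * real L)\<^sup>2" by (intro power_mono) auto
  moreover have "real L \<le> real L * real L" by (cases L) auto
  ultimately show ?thesis by (simp add: power2_eq_square)
qed

theorem theorem2:
  fixes lam \<delta> :: real
    and c :: nat
    and enumM :: "nat \<Rightarrow> nat \<Rightarrow> nat list enumeration"
    and enumS :: "nat list \<Rightarrow> int list enumeration"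
  assumes "0 \<le> lam"
    and "0 < \<delta>" and "\<delta> < 1"
    and "\<And>k N. generates c (multisets k N) (enumM k N)"
    and "\<And>b. set b \<subseteq> {0, 1} \<Longrightarrow> generates c (sign_perm b) (enumS b)"
  shows "\<exists>C::real. \<forall>n\<ge>1. \<forall>m. \<forall>(f :: int list \<Rightarrow> real) (g :: int list \<Rightarrow> real list).
           (\<forall>x. length x = n \<longrightarrow> length (g x) = m) \<longrightarrow>
           solves (outcome (algorithm1 enumM enumS f g n lam)) f g n lam \<and>
           real (steps (algorithm1 enumM enumS f g n lam))
             \<le> C * real n powr (((2 + \<delta>) * real_of_int \<lfloor>lam\<rfloor>)\<^sup>2 / 2 + 1)"
proof -
  define L where "L = nat \<lfloor>lam\<rfloor>"
  define C :: nat where "C = 1 + 2 ^ L * 2 ^ L * (2 * c + 7)"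
  have floor: "real_of_int \<lfloor>lam\<rfloor> = real L" using assms(1) by (simp add: L_def)
  show ?thesis
  proof (intro exI[of _ "real C"] allI impI conjI)
    fix n m :: nat and f :: "int list \<Rightarrow> real" and g :: "int list \<Rightarrow> real list"
    assume n: "1 \<le> n"
    let ?p = "algorithm1 enumM enumS f g n lam"
    let ?xs = "concat (map (\<lambda>u. map (hadamard (phi u)) (map fst (enumS (support (phi u)))))
      (map fst (enumM n (Suc L))))"
    have run: "runs_to ?p (fold (update f g) ?xs (None, \<infinity>))
        (1 + Suc n ^ L * (c + (n + (n + 2 ^ L * (c + (2 * n + 3))))))"
      by (rule runs_to_algorithm1[OF assms(4,5) L_def])
    have "set (map fst (enumM n (Suc L))) = multisets n (Suc L)"
      using assms(4) by (simp add: generates_def)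
    moreover have "set (map fst (enumS (support v))) = sign_perm (support v)" for v
      using assms(5)[OF set_support] by (simp add: generates_def)
    ultimately have "set ?xs
        = (\<Union>u\<in>multisets n (Suc L). hadamard (phi u) ` sign_perm (support (phi u)))"
      by (simp only: set_concat set_map image_image)
    then have "{x \<in> set ?xs. nonpos (g x)} = feasible g n lam"
      unfolding candidates_eq_ball feasible_eq_ball[OF assms(1)] L_def by simp
    with fold_update_minimises[of f g ?xs] show "solves (outcome ?p) f g n lam"
      by (simp only: outcome_runs_to[OF run] solves_iff_minimises)
    have "steps ?p \<le> C * n ^ Suc L"
      unfolding C_def using steps_runs_to[OF run] step_count_le[OF n] by (rule order_trans)
    then have "real (steps ?p) \<le> real (C * n ^ Suc L)" by (simp only: of_nat_le_iff)
    also have "\<dots> = real C * real n powr real (Suc L)"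
      using n by (subst powr_realpow) auto
    also have "\<dots> \<le> real C * real n powr (((2 + \<delta>) * real L)\<^sup>2 / 2 + 1)"
    proof (intro mult_left_mono powr_mono)
      show "real (Suc L) \<le> ((2 + \<delta>) * real L)\<^sup>2 / 2 + 1"
        by (rule exponent_le) (use assms(2) in simp)
    qed (use n in simp_all)
    finally show "real (steps ?p)
        \<le> real C * real n powr (((2 + \<delta>) * real_of_int \<lfloor>lam\<rfloor>)\<^sup>2 / 2 + 1)"
      by (simp only: floor)
  qed
qed

end
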